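(* Let $\Gamma$ be a countable discrete group and let $(X,\Gamma)$ be a $\Gamma$-flow. Assume that the set $\Lambda^f_\epsilon=\{s\in\Gamma:\ \|s.f-f\|_\infty<\epsilon\}$ is plump in $\Gamma$ for every $f\in C(X)$ and every $\epsilon>0$. Then $C(X)\rtimes_r\Gamma$ is almost reflecting.
   Context: A $\Gamma$-flow $(X,\Gamma)$ is an action of $\Gamma$ by homeomorphisms on a compact Hausdorff space $X$; for $f\in C(X)$, $(s.f)(x)=f(s^{-1}x)$. A non-empty subset $\Lambda\subset\Gamma$ is plump in $\Gamma$ if for every $\epsilon>0$ and every finite collection $t_1,\dots,t_n\in\Gamma\setminus\{e\}$ there are $s_1,\dots,s_m\in\Lambda$ such that $$\Big\|\frac1m\sum_{j=1}^m\lambda(s_jt_is_j^{-1})\Big\|<\epsilon,\qquad i=1,\dots,n,$$ where $\lambda$ is the left regular representation of $\Gamma$ and the norm is the operator norm. $C(X)\rtimes_r\Gamma$ is the reduced crossed product, $C^*_r(\Gamma)\subset C(X)\rtimes_r\Gamma$ is the reduced group $C^*$-algebra generated by the canonical unitaries, and $\mathbb{E}:C(X)\rtimes_r\Gamma\to C(X)$ is the canonical conditional expectation. $C(X)\rtimes_r\Gamma$ is almost reflecting if every intermediate $C^*$-algebra $C^*_r(\Gamma)\subset\mathcal{A}\subset C(X)\rtimes_r\Gamma$ satisfies $\mathbb{E}(\mathcal{A})\subset\mathcal{A}$. *)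

theory Defs
  imports "HOL-Analysis.Analysis"
begin

section \<open>The Hilbert space of square-summable families\<close>

typedef 'i ell2 = "{f :: 'i \<Rightarrow> complex. (\<lambda>i. (cmod (f i))\<^sup>2) summable_on UNIV}"
  morphisms ell2_apply Abs_ell2
  by (rule exI[of _ "\<lambda>_. 0"]) simp

setup_lifting type_definition_ell2

lemma ell2_eqI: "(\<And>i. ell2_apply x i = ell2_apply y i) \<Longrightarrow> x = y"
  by transfer auto

lemma ell2_summable: "(\<lambda>i. (cmod (ell2_apply x i))\<^sup>2) summable_on UNIV"
  using ell2_apply[of x] by simp

lemma cmod_add_square_le: "(cmod (a + b))\<^sup>2 \<le> 2 * (cmod a)\<^sup>2 + 2 * (cmod b)\<^sup>2"
proof -
  have "(cmod (a + b))\<^sup>2 \<le> (cmod a + cmod b)\<^sup>2"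
    by (intro power_mono norm_triangle_ineq) auto
  also have "\<dots> \<le> 2 * (cmod a)\<^sup>2 + 2 * (cmod b)\<^sup>2"
    using sum_squares_bound[of "cmod a" "cmod b"] by (simp add: power2_sum)
  finally show ?thesis .
qed

lemma square_summable_add:
  assumes "(\<lambda>i. (cmod (f i))\<^sup>2) summable_on UNIV" "(\<lambda>i. (cmod (g i))\<^sup>2) summable_on UNIV"
  shows "(\<lambda>i. (cmod (f i + g i))\<^sup>2) summable_on UNIV"
proof (rule summable_on_comparison_test)
  show "(\<lambda>i. 2 * (cmod (f i))\<^sup>2 + 2 * (cmod (g i))\<^sup>2) summable_on UNIV"
    using assms by (intro summable_on_add summable_on_cmult_right)
qed (auto intro: cmod_add_square_le)

lemma square_summable_bounded_mult:
  assumes "(\<lambda>i. (cmod (f i))\<^sup>2) summable_on UNIV" "\<And>i. cmod (d i) \<le> B"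
  shows "(\<lambda>i. (cmod (d i * f i))\<^sup>2) summable_on UNIV"
proof (rule summable_on_comparison_test)
  show "(\<lambda>i. B\<^sup>2 * (cmod (f i))\<^sup>2) summable_on UNIV"
    using assms(1) by (rule summable_on_cmult_right)
  show "(cmod (d i * f i))\<^sup>2 \<le> B\<^sup>2 * (cmod (f i))\<^sup>2" for i
    using assms(2)[of i] by (auto simp: norm_mult power_mult_distrib intro!: mult_right_mono power_mono)
qed auto

lemma cmod_mult_le_squares: "cmod (a * b) \<le> (cmod a)\<^sup>2 + (cmod b)\<^sup>2"
proof -
  have "2 * (cmod a * cmod b) \<le> (cmod a)\<^sup>2 + (cmod b)\<^sup>2"
    using sum_squares_bound[of "cmod a" "cmod b"] by simp
  moreover have "0 \<le> cmod a * cmod b" by simp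
  ultimately show ?thesis unfolding norm_mult by linarith
qed

lemma square_summable_mult:
  assumes "(\<lambda>i. (cmod (f i))\<^sup>2) summable_on UNIV" "(\<lambda>i. (cmod (g i))\<^sup>2) summable_on UNIV"
  shows "(\<lambda>i. cnj (f i) * g i) summable_on UNIV"
proof (rule abs_summable_summable, rule summable_on_comparison_test)
  show "(\<lambda>i. (cmod (f i))\<^sup>2 + (cmod (g i))\<^sup>2) summable_on UNIV"
    using assms by (rule summable_on_add)
  show "cmod (cnj (f i) * g i) \<le> (cmod (f i))\<^sup>2 + (cmod (g i))\<^sup>2" for i
    using cmod_mult_le_squares[of "cnj (f i)" "g i"] by simp
qed auto

definition cinner :: "'i ell2 \<Rightarrow> 'i ell2 \<Rightarrow> complex" where
  "cinner x y = (\<Sum>\<^sub>\<infinity>i. cnj (ell2_apply x i) * ell2_apply y i)"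

lemma cinner_summable: "(\<lambda>i. cnj (ell2_apply x i) * ell2_apply y i) summable_on UNIV"
  by (intro square_summable_mult ell2_summable)

text \<open>The class \<^class>\<open>real_inner\<close> is instantiated with the real part of the complex inner product;
  the norm it determines is the usual one.\<close>

instantiation ell2 :: (type) real_inner
begin

lift_definition zero_ell2 :: "'a ell2" is "\<lambda>_. 0" by simp

lift_definition plus_ell2 :: "'a ell2 \<Rightarrow> 'a ell2 \<Rightarrow> 'a ell2" is "\<lambda>f g i. f i + g i"
  by (simp add: square_summable_add)

lift_definition uminus_ell2 :: "'a ell2 \<Rightarrow> 'a ell2" is "\<lambda>f i. - f i" by simp

lift_definition minus_ell2 :: "'a ell2 \<Rightarrow> 'a ell2 \<Rightarrow> 'a ell2" is "\<lambda>f g i. f i - g i"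
  using square_summable_add[where g = "\<lambda>i. - g i" for g] by force

lift_definition scaleR_ell2 :: "real \<Rightarrow> 'a ell2 \<Rightarrow> 'a ell2" is "\<lambda>r f i. complex_of_real r * f i"
  using square_summable_bounded_mult[where d = "\<lambda>_. complex_of_real r" and B = "\<bar>r\<bar>" for r] by force

definition inner_ell2 :: "'a ell2 \<Rightarrow> 'a ell2 \<Rightarrow> real" where
  "inner_ell2 x y = Re (cinner x y)"

definition norm_ell2 :: "'a ell2 \<Rightarrow> real" where
  "norm_ell2 x = sqrt (inner x x)"

definition dist_ell2 :: "'a ell2 \<Rightarrow> 'a ell2 \<Rightarrow> real" where
  "dist_ell2 x y = norm (x - y)"

definition sgn_ell2 :: "'a ell2 \<Rightarrow> 'a ell2" where
  "sgn_ell2 x = inverse (norm x) *\<^sub>R x"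

definition uniformity_ell2 :: "('a ell2 \<times> 'a ell2) filter" where
  "uniformity_ell2 = (INF e\<in>{0<..}. principal {(x, y). dist x y < e})"

definition open_ell2 :: "'a ell2 set \<Rightarrow> bool" where
  "open_ell2 S \<longleftrightarrow> (\<forall>x\<in>S. \<forall>\<^sub>F (x', y) in uniformity. x' = x \<longrightarrow> y \<in> S)"

instance
proof
  fix x y z :: "'a ell2" and r s :: real
  show "x + y + z = x + (y + z)" by transfer (simp add: add.assoc)
  show "x + y = y + x" by transfer (simp add: add.commute)
  show "0 + x = x" by transfer simp
  show "- x + x = 0" by transfer simp
  show "x - y = x + - y" by transfer simp
  show "r *\<^sub>R (x + y) = r *\<^sub>R x + r *\<^sub>R y" by transfer (simp add: algebra_simps)
  show "(r + s) *\<^sub>R x = r *\<^sub>R x + s *\<^sub>R x" by transfer (simp add: algebra_simps)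
  show "r *\<^sub>R s *\<^sub>R x = (r * s) *\<^sub>R x" by transfer (simp add: algebra_simps)
  show "1 *\<^sub>R x = x" by transfer simp
  show "dist x y = norm (x - y)" by (rule dist_ell2_def)
  show "sgn x = inverse (norm x) *\<^sub>R x" by (rule sgn_ell2_def)
  show "(uniformity :: ('a ell2 \<times> 'a ell2) filter) = (INF e\<in>{0<..}. principal {(x, y). dist x y < e})"
    by (rule uniformity_ell2_def)
  show "open U \<longleftrightarrow> (\<forall>x\<in>U. \<forall>\<^sub>F (x', y) in uniformity. x' = x \<longrightarrow> y \<in> U)" for U :: "'a ell2 set"
    by (rule open_ell2_def)
  show "norm x = sqrt (inner x x)" by (rule norm_ell2_def)
  have Re_cinner: "inner x y = (\<Sum>\<^sub>\<infinity>i. Re (cnj (ell2_apply x i) * ell2_apply y i))" for x y :: "'a ell2"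
    unfolding inner_ell2_def cinner_def using infsum_Re[OF cinner_summable] by metis
  show "inner x y = inner y x" by (simp add: Re_cinner mult.commute)
  have "cinner (x + y) z = cinner x z + cinner y z"
    unfolding cinner_def
    by (subst infsum_add[symmetric]) (auto simp: cinner_summable plus_ell2.rep_eq ring_distribs)
  then show "inner (x + y) z = inner x z + inner y z" by (simp add: inner_ell2_def)
  have "cinner (r *\<^sub>R x) y = complex_of_real r * cinner x y"
    unfolding cinner_def by (subst infsum_cmult_right'[symmetric]) (simp add: scaleR_ell2.rep_eq mult.assoc)
  then show "inner (r *\<^sub>R x) y = r * inner x y" by (simp add: inner_ell2_def)
  have sq: "inner x x = (\<Sum>\<^sub>\<infinity>i. (cmod (ell2_apply x i))\<^sup>2)"
    unfolding Re_cinner by (intro infsum_cong) (simp add: cmod_power2 flip: power2_eq_square)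
  show "0 \<le> inner x x" unfolding sq by (intro infsum_nonneg) auto
  show "inner x x = 0 \<longleftrightarrow> x = 0"
  proof
    assume "inner x x = 0"
    then have "(cmod (ell2_apply x i))\<^sup>2 = 0" for i
      using nonneg_infsum_le_0D[of "\<lambda>i. (cmod (ell2_apply x i))\<^sup>2" UNIV i] ell2_summable[of x] sq by auto
    then show "x = 0" by (intro ell2_eqI) (simp add: zero_ell2.rep_eq)
  qed (simp add: Re_cinner zero_ell2.rep_eq)
qed

end

lemma norm_ell2_square: "(norm x)\<^sup>2 = (\<Sum>\<^sub>\<infinity>i. (cmod (ell2_apply x i))\<^sup>2)"
proof -
  have "(norm x)\<^sup>2 = Re (cinner x x)"
    by (simp add: power2_norm_eq_inner inner_ell2_def)
  also have "\<dots> = (\<Sum>\<^sub>\<infinity>i. Re (cnj (ell2_apply x i) * ell2_apply x i))"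
    unfolding cinner_def using infsum_Re[OF cinner_summable] by metis
  also have "\<dots> = (\<Sum>\<^sub>\<infinity>i. (cmod (ell2_apply x i))\<^sup>2)"
    by (intro infsum_cong) (simp add: cmod_power2 flip: power2_eq_square)
  finally show ?thesis .
qed

lemma cmod_ell2_apply_le: "cmod (ell2_apply x i) \<le> norm x"
proof (rule power2_le_imp_le)
  show "(cmod (ell2_apply x i))\<^sup>2 \<le> (norm x)\<^sup>2"
    unfolding norm_ell2_square
    using finite_sum_le_infsum[OF ell2_summable, of "{i}" x] by simp
qed simp

lift_definition ket :: "'i \<Rightarrow> 'i ell2" is "\<lambda>i j. if j = i then 1 else 0"
proof -
  fix i :: 'i
  have "(\<lambda>j. (cmod (if j = i then 1 else 0 :: complex))\<^sup>2) summable_on {i}" by simp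
  then show "(\<lambda>j. (cmod (if j = i then 1 else 0 :: complex))\<^sup>2) summable_on UNIV"
    by (rule summable_on_cong_neutral[THEN iffD1, rotated -1]) auto
qed

lemma norm_ket [simp]: "norm (ket i) = 1"
proof -
  have "(norm (ket i))\<^sup>2 = (\<Sum>\<^sub>\<infinity>j\<in>{i}. (cmod (ell2_apply (ket i) j))\<^sup>2)"
    unfolding norm_ell2_square by (rule infsum_cong_neutral) (auto simp: ket.rep_eq)
  then have "(norm (ket i))\<^sup>2 = 1" by (simp add: ket.rep_eq)
  then show ?thesis by (simp add: power2_eq_1_iff) (metis norm_ge_zero not_one_le_zero neg_0_le_iff_le)
qed

section \<open>Operators\<close>

text \<open>Bounded operators are elements of the library type \<^typ>\<open>'i ell2 \<Rightarrow>\<^sub>L 'i ell2\<close> of bounded real-linear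
  maps; its norm is the operator norm.  The operators considered below are all complex-linear, and
  complex linearity is part of the definition of a C*-algebra of operators.\<close>

lift_definition mult_fun :: "('i \<Rightarrow> complex) \<Rightarrow> 'i ell2 \<Rightarrow> 'i ell2" is
  "\<lambda>d f. if bounded (range d) then (\<lambda>i. d i * f i) else (\<lambda>_. 0)"
proof -
  fix d f :: "'i \<Rightarrow> complex"
  assume f: "(\<lambda>i. (cmod (f i))\<^sup>2) summable_on UNIV"
  show "(\<lambda>i. (cmod ((if bounded (range d) then \<lambda>i. d i * f i else (\<lambda>_. 0)) i))\<^sup>2) summable_on UNIV"
  proof (cases "bounded (range d)")
    case True
    then obtain B where "\<And>i. cmod (d i) \<le> B" by (auto simp: bounded_iff)
    with f True show ?thesis by (auto intro: square_summable_bounded_mult)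
  qed simp
qed

lemma norm_mult_fun_le:
  assumes "\<And>i. cmod (d i) \<le> B"
  shows "norm (mult_fun d x) \<le> B * norm x"
proof (rule power2_le_imp_le)
  have bd: "bounded (range d)" using assms by (auto simp: bounded_iff)
  have "(norm (mult_fun d x))\<^sup>2 = (\<Sum>\<^sub>\<infinity>i. (cmod (d i * ell2_apply x i))\<^sup>2)"
    by (simp add: norm_ell2_square mult_fun.rep_eq bd)
  also have "\<dots> \<le> (\<Sum>\<^sub>\<infinity>i. B\<^sup>2 * (cmod (ell2_apply x i))\<^sup>2)"
  proof (rule infsum_mono)
    show "(cmod (d i * ell2_apply x i))\<^sup>2 \<le> B\<^sup>2 * (cmod (ell2_apply x i))\<^sup>2" for i
      using assms[of i] by (auto simp: norm_mult power_mult_distrib intro!: mult_right_mono power_mono)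
  qed (intro square_summable_bounded_mult[OF ell2_summable assms] summable_on_cmult_right ell2_summable)+
  also have "\<dots> = (B * norm x)\<^sup>2"
    by (simp add: infsum_cmult_right' norm_ell2_square power_mult_distrib)
  finally show "(norm (mult_fun d x))\<^sup>2 \<le> (B * norm x)\<^sup>2" .
  have "0 \<le> B" using assms norm_ge_zero order_trans by blast
  then show "0 \<le> B * norm x" by simp
qed

lemma bounded_linear_mult_fun: "bounded_linear (mult_fun d)"
proof -
  have bd: "\<exists>B. \<forall>x. norm (mult_fun d x) \<le> norm x * B"
  proof (cases "bounded (range d)")
    case True
    then obtain B where "\<And>i. cmod (d i) \<le> B" by (auto simp: bounded_iff)
    then show ?thesis using norm_mult_fun_le by (metis mult.commute)
  next
    case False
    then have "mult_fun d x = 0" for x by (intro ell2_eqI) (simp add: mult_fun.rep_eq zero_ell2.rep_eq)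
    then show ?thesis by (intro exI[of _ 0]) simp
  qed
  have add: "mult_fun d (x + y) = mult_fun d x + mult_fun d y" for x y
    by (rule ell2_eqI) (simp add: mult_fun.rep_eq plus_ell2.rep_eq distrib_left)
  have scale: "mult_fun d (r *\<^sub>R x) = r *\<^sub>R mult_fun d x" for r x
    by (rule ell2_eqI) (simp add: mult_fun.rep_eq scaleR_ell2.rep_eq)
  from bd obtain B where "\<And>x. norm (mult_fun d x) \<le> norm x * B" by blast
  with add scale show ?thesis by (rule bounded_linear_intro)
qed

text \<open>Pointwise multiplication by a bounded family \<open>d\<close> (and \<open>0\<close> if \<open>d\<close> is unbounded).\<close>

lift_definition mult_op :: "('i \<Rightarrow> complex) \<Rightarrow> 'i ell2 \<Rightarrow>\<^sub>L 'i ell2" is mult_fun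
  by (rule bounded_linear_mult_fun)

lemma mult_op_apply:
  "bounded (range d) \<Longrightarrow> ell2_apply (mult_op d x) i = d i * ell2_apply x i"
  by (simp add: mult_op.rep_eq mult_fun.rep_eq)

lift_definition perm_fun :: "('i \<Rightarrow> 'i) \<Rightarrow> 'i ell2 \<Rightarrow> 'i ell2" is
  "\<lambda>\<sigma> f. if bij \<sigma> then (\<lambda>i. f (\<sigma> i)) else (\<lambda>_. 0)"
proof -
  fix \<sigma> :: "'i \<Rightarrow> 'i" and f :: "'i \<Rightarrow> complex"
  assume f: "(\<lambda>i. (cmod (f i))\<^sup>2) summable_on UNIV"
  show "(\<lambda>i. (cmod ((if bij \<sigma> then \<lambda>i. f (\<sigma> i) else (\<lambda>_. 0)) i))\<^sup>2) summable_on UNIV"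
  proof (cases "bij \<sigma>")
    case True
    show ?thesis
      using summable_on_reindex_bij_betw[OF True, of "\<lambda>i. (cmod (f i))\<^sup>2"] f True by simp
  qed simp
qed

lemma norm_perm_fun:
  assumes "bij \<sigma>"
  shows "norm (perm_fun \<sigma> x) = norm x"
proof -
  have "(norm (perm_fun \<sigma> x))\<^sup>2 = (\<Sum>\<^sub>\<infinity>i. (cmod (ell2_apply x (\<sigma> i)))\<^sup>2)"
    using assms by (simp add: norm_ell2_square perm_fun.rep_eq)
  also have "\<dots> = (norm x)\<^sup>2"
    unfolding norm_ell2_square
    by (rule infsum_reindex_bij_betw[OF assms, of "\<lambda>i. (cmod (ell2_apply x i))\<^sup>2"])
  finally show ?thesis by (simp add: power2_eq_iff_nonneg)
qed

lemma bounded_linear_perm_fun: "bounded_linear (perm_fun \<sigma>)"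
proof -
  have "norm (perm_fun \<sigma> x) \<le> norm x * 1" for x
  proof (cases "bij \<sigma>")
    case False
    then have "perm_fun \<sigma> x = 0" by (intro ell2_eqI) (simp add: perm_fun.rep_eq zero_ell2.rep_eq)
    then show ?thesis by simp
  qed (simp add: norm_perm_fun)
  then have bd: "\<exists>B. \<forall>x. norm (perm_fun \<sigma> x) \<le> norm x * B" by blast
  have add: "perm_fun \<sigma> (x + y) = perm_fun \<sigma> x + perm_fun \<sigma> y" for x y
    by (rule ell2_eqI) (simp add: perm_fun.rep_eq plus_ell2.rep_eq)
  have scale: "perm_fun \<sigma> (r *\<^sub>R x) = r *\<^sub>R perm_fun \<sigma> x" for r x
    by (rule ell2_eqI) (simp add: perm_fun.rep_eq scaleR_ell2.rep_eq)
  from bd obtain B where "\<And>x. norm (perm_fun \<sigma> x) \<le> norm x * B" by blast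
  with add scale show ?thesis by (rule bounded_linear_intro)
qed

text \<open>Composition with a bijection \<open>\<sigma>\<close> (and \<open>0\<close> if \<open>\<sigma>\<close> is not bijective).\<close>

lift_definition perm_op :: "('i \<Rightarrow> 'i) \<Rightarrow> 'i ell2 \<Rightarrow>\<^sub>L 'i ell2" is perm_fun
  by (rule bounded_linear_perm_fun)

lemma perm_op_apply: "bij \<sigma> \<Longrightarrow> ell2_apply (perm_op \<sigma> x) i = ell2_apply x (\<sigma> i)"
  by (simp add: perm_op.rep_eq perm_fun.rep_eq)

definition scaleC_op :: "complex \<Rightarrow> ('i ell2 \<Rightarrow>\<^sub>L 'i ell2) \<Rightarrow> ('i ell2 \<Rightarrow>\<^sub>L 'i ell2)" where
  "scaleC_op c a = mult_op (\<lambda>_. c) o\<^sub>L a"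

lemma scaleC_op_apply: "ell2_apply (scaleC_op c a x) i = c * ell2_apply (a x) i"
  by (simp add: scaleC_op_def mult_op_apply)

definition complex_linear_op :: "('i ell2 \<Rightarrow>\<^sub>L 'i ell2) \<Rightarrow> bool" where
  "complex_linear_op a \<longleftrightarrow> (\<forall>c x. a (mult_op (\<lambda>_. c) x) = mult_op (\<lambda>_. c) (a x))"

definition is_adjoint :: "('i ell2 \<Rightarrow>\<^sub>L 'i ell2) \<Rightarrow> ('i ell2 \<Rightarrow>\<^sub>L 'i ell2) \<Rightarrow> bool" where
  "is_adjoint a b \<longleftrightarrow> (\<forall>x y. cinner (a x) y = cinner x (b y))"

definition cstar_algebra :: "('i ell2 \<Rightarrow>\<^sub>L 'i ell2) set \<Rightarrow> bool" where
  "cstar_algebra A \<longleftrightarrow>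
     0 \<in> A \<and>
     (\<forall>a\<in>A. \<forall>b\<in>A. a + b \<in> A) \<and>
     (\<forall>a\<in>A. \<forall>c. scaleC_op c a \<in> A) \<and>
     (\<forall>a\<in>A. \<forall>b\<in>A. a o\<^sub>L b \<in> A) \<and>
     (\<forall>a\<in>A. \<exists>b\<in>A. is_adjoint a b) \<and>
     (\<forall>a\<in>A. complex_linear_op a) \<and>
     closed A"

section \<open>Groups, flows, and plump subsets\<close>

text \<open>A group is a type of class \<^class>\<open>group_add\<close>, which is not assumed to be commutative: the
  product \<open>st\<close> is written \<open>s + t\<close>, the inverse \<open>- s\<close>, the neutral element \<open>0\<close>, and \<open>s + t - s\<close> is
  the conjugate of \<open>t\<close> by \<open>s\<close>.\<close>

definition left_regular :: "'g::group_add \<Rightarrow> 'g ell2 \<Rightarrow>\<^sub>L 'g ell2" where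
  "left_regular t = perm_op (\<lambda>s. - t + s)"

definition plump :: "'g::group_add set \<Rightarrow> bool" where
  "plump \<Lambda> \<longleftrightarrow> \<Lambda> \<noteq> {} \<and>
     (\<forall>\<epsilon>>0. \<forall>T. finite T \<and> T \<subseteq> - {0} \<longrightarrow>
       (\<exists>(m::nat) s. m > 0 \<and> (\<forall>j<m. s j \<in> \<Lambda>) \<and>
         (\<forall>t\<in>T. norm ((1 / real m) *\<^sub>R (\<Sum>j<m. left_regular (s j + t - s j))) < \<epsilon>)))"

definition flow :: "('g::group_add \<Rightarrow> 'x::t2_space \<Rightarrow> 'x) \<Rightarrow> bool" where
  "flow act \<longleftrightarrow> compact (UNIV :: 'x set) \<and>
     (\<forall>x. act 0 x = x) \<and> (\<forall>s t x. act (s + t) x = act s (act t x)) \<and>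
     (\<forall>s. homeomorphism UNIV UNIV (act s) (act (- s)))"

text \<open>As the space is compact, its algebra of continuous functions is the library type
  \<^typ>\<open>'x \<Rightarrow>\<^sub>C complex\<close> of bounded continuous functions with the supremum norm.\<close>

definition translate ::
    "('g::group_add \<Rightarrow> 'x::t2_space \<Rightarrow> 'x) \<Rightarrow> 'g \<Rightarrow> ('x \<Rightarrow>\<^sub>C complex) \<Rightarrow> ('x \<Rightarrow>\<^sub>C complex)" where
  "translate act s f = Bcontfun (\<lambda>x. f (act (- s) x))"

lemma apply_translate:
  assumes "flow act"
  shows "apply_bcontfun (translate act s f) x = f (act (- s) x)"
proof -
  have "continuous_on UNIV (act (- s))"
    using assms by (auto simp: flow_def homeomorphism_def)
  then have "continuous_on UNIV (\<lambda>x. f (act (- s) x))"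
    by (rule continuous_on_compose2[OF continuous_on_apply_bcontfun[of UNIV]]) auto
  moreover have "bounded (range (\<lambda>x. f (act (- s) x)))"
    by (rule bounded_subset[OF bounded_apply_bcontfun[of f]]) auto
  ultimately show ?thesis
    by (simp add: translate_def Bcontfun_inverse bcontfun_def)
qed

section \<open>The reduced crossed product\<close>

text \<open>The algebra of continuous functions is represented faithfully by multiplication operators on
  the square-summable families over the set of points of the space.  The regular representation induced from
  it acts on families over \<open>\<Gamma> \<times> X\<close>; \<open>coeff_op\<close> and \<open>unitary_op\<close> are its restrictions to the functions
  and to the group.\<close>

definition coeff_op ::
    "('g::group_add \<Rightarrow> 'x::t2_space \<Rightarrow> 'x) \<Rightarrow> ('x \<Rightarrow>\<^sub>C complex) \<Rightarrow> ('g \<times> 'x) ell2 \<Rightarrow>\<^sub>L ('g \<times> 'x) ell2" where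
  "coeff_op act f = mult_op (\<lambda>(s, x). f (act s x))"

definition unitary_op :: "'g::group_add \<Rightarrow> ('g \<times> 'x) ell2 \<Rightarrow>\<^sub>L ('g \<times> 'x) ell2" where
  "unitary_op t = perm_op (\<lambda>(s, x). (- t + s, x))"

lemma bij_left_shift: "bij (\<lambda>s. - t + s :: 'g::group_add)"
  by (rule bij_betwI[where g = "\<lambda>s. t + s"]) (auto simp: add.assoc[symmetric])

lemma left_regular_apply: "ell2_apply (left_regular t \<xi>) s = ell2_apply \<xi> (- t + s)"
  by (simp add: left_regular_def perm_op_apply[OF bij_left_shift])

lemma bij_left_shift_fst: "bij (\<lambda>(s, x). (- t + s :: 'g::group_add, x))"
  by (rule bij_betwI[where g = "\<lambda>(s, x). (t + s, x)"]) (auto simp: add.assoc[symmetric])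

lemma unitary_op_apply: "ell2_apply (unitary_op t \<xi>) (s, x) = ell2_apply \<xi> (- t + s, x)"
  by (simp add: unitary_op_def perm_op_apply[OF bij_left_shift_fst])

lemma bounded_coeff: "bounded (range (\<lambda>(s, x). apply_bcontfun f (act s x)))"
  by (rule bounded_subset[OF bounded_apply_bcontfun[of f]]) auto

lemma coeff_op_apply: "ell2_apply (coeff_op act f \<xi>) (s, x) = f (act s x) * ell2_apply \<xi> (s, x)"
  by (simp add: coeff_op_def mult_op_apply[OF bounded_coeff])

lemma covariance:
  assumes "flow act"
  shows "unitary_op t o\<^sub>L coeff_op act f o\<^sub>L unitary_op (- t) = coeff_op act (translate act t f)"
proof (intro blinfun_eqI ell2_eqI)
  fix \<xi> and i :: "'a \<times> 'b"
  have "act (- t + fst i) (snd i) = act (- t) (act (fst i) (snd i))"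
    using assms by (simp add: flow_def)
  then show "ell2_apply ((unitary_op t o\<^sub>L coeff_op act f o\<^sub>L unitary_op (- t)) \<xi>) i
      = ell2_apply (coeff_op act (translate act t f) \<xi>) i"
    by (cases i) (simp add: unitary_op_apply coeff_op_apply apply_translate[OF assms] add.assoc[symmetric])
qed

definition reduced_crossed_product ::
    "('g::group_add \<Rightarrow> 'x::t2_space \<Rightarrow> 'x) \<Rightarrow> (('g \<times> 'x) ell2 \<Rightarrow>\<^sub>L ('g \<times> 'x) ell2) set" where
  "reduced_crossed_product act =
     closure {\<Sum>t\<in>F. coeff_op act (f t) o\<^sub>L unitary_op t | F f. finite F}"

text \<open>The canonical copy of the reduced group C*-algebra inside the crossed product.  The unitaries
  form a group, so the C*-algebra they generate is the closure of their complex linear span.\<close>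

definition reduced_group_algebra :: "(('g::group_add \<times> 'x) ell2 \<Rightarrow>\<^sub>L ('g \<times> 'x) ell2) set" where
  "reduced_group_algebra = closure {\<Sum>t\<in>F. scaleC_op (c t) (unitary_op t) | F c. finite F}"

text \<open>The canonical conditional expectation compresses an operator to the neutral element of the
  group, i.e. it takes the diagonal matrix coefficients at the points \<open>(e, x)\<close>.  The lemmas below
  show that this is the contractive extension of \<open>\<Sum>\<^sub>t f\<^sub>t u\<^sub>t \<mapsto> f\<^sub>e\<close>.\<close>

definition canonical_expectation ::
    "(('g::group_add \<times> 'x::t2_space) ell2 \<Rightarrow>\<^sub>L ('g \<times> 'x) ell2) \<Rightarrow> ('x \<Rightarrow>\<^sub>C complex)" where
  "canonical_expectation a = Bcontfun (\<lambda>x. cinner (ket (0, x)) (a (ket (0, x))))"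

definition almost_reflecting :: "('g::group_add \<Rightarrow> 'x::t2_space \<Rightarrow> 'x) \<Rightarrow> bool" where
  "almost_reflecting act \<longleftrightarrow>
     (\<forall>A. cstar_algebra A \<and> reduced_group_algebra \<subseteq> A \<and> A \<subseteq> reduced_crossed_product act \<longrightarrow>
       (\<lambda>a. coeff_op act (canonical_expectation a)) ` A \<subseteq> A)"

lemma cinner_ket: "cinner (ket i) \<xi> = ell2_apply \<xi> i"
proof -
  have "cinner (ket i) \<xi> = (\<Sum>\<^sub>\<infinity>j\<in>{i}. cnj (ell2_apply (ket i) j) * ell2_apply \<xi> j)"
    unfolding cinner_def by (rule infsum_cong_neutral) (auto simp: ket.rep_eq)
  then show ?thesis by (simp add: ket.rep_eq)
qed

lemma cmod_diagonal_coefficient_le: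
  fixes a :: "'i ell2 \<Rightarrow>\<^sub>L 'i ell2"
  shows "cmod (cinner (ket i) (a (ket i))) \<le> norm a"
  using cmod_ell2_apply_le[of "a (ket i)" i] norm_blinfun[of a "ket i"] by (simp add: cinner_ket)

lemma cinner_ket_diff: "cinner (ket i) (\<xi> - \<eta>) = cinner (ket i) \<xi> - cinner (ket i) \<eta>"
  by (simp add: cinner_ket minus_ell2.rep_eq)

lemma ell2_apply_sum: "ell2_apply (\<Sum>t\<in>F. \<xi> t) i = (\<Sum>t\<in>F. ell2_apply (\<xi> t) i)"
  by (induction F rule: infinite_finite_induct) (auto simp: zero_ell2.rep_eq plus_ell2.rep_eq)

lemma blinfun_apply_sum: "blinfun_apply (\<Sum>t\<in>F. a t) \<xi> = (\<Sum>t\<in>F. blinfun_apply (a t) \<xi>)"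
  by (induction F rule: infinite_finite_induct) (auto simp: blinfun.add_left)

lemma diagonal_coefficient_finite_sum:
  assumes "flow act" "finite F"
  shows "cinner (ket (0, x)) (blinfun_apply (\<Sum>t\<in>F. coeff_op act (f t) o\<^sub>L unitary_op t) (ket (0, x)))
    = (if 0 \<in> F then f 0 x else 0)"
proof -
  have "cinner (ket (0, x)) (blinfun_apply (\<Sum>t\<in>F. coeff_op act (f t) o\<^sub>L unitary_op t) (ket (0, x)))
      = (\<Sum>t\<in>F. if t = 0 then f 0 x else 0)"
    unfolding cinner_ket blinfun_apply_sum ell2_apply_sum using assms(1)
    by (intro sum.cong) (auto simp: coeff_op_apply unitary_op_apply ket.rep_eq flow_def)
  then show ?thesis using assms(2) by simp
qed

lemma diagonal_coefficients_bcontfun: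
  assumes "flow act" "a \<in> reduced_crossed_product act"
  shows "(\<lambda>x. cinner (ket (0, x)) (a (ket (0, x)))) \<in> bcontfun"
proof -
  obtain p where p: "\<And>n. p n \<in> {\<Sum>t\<in>F. coeff_op act (f t) o\<^sub>L unitary_op t | F f. finite F}"
    and lim: "p \<longlonglongrightarrow> a"
    using assms(2) unfolding reduced_crossed_product_def closure_sequential by blast
  have "continuous_on UNIV (\<lambda>x. cinner (ket (0, x)) (p n (ket (0, x))))" for n
  proof -
    obtain F f where F: "finite F" "p n = (\<Sum>t\<in>F. coeff_op act (f t) o\<^sub>L unitary_op t)"
      using p[of n] by blast
    have eq: "(\<lambda>x. cinner (ket (0, x)) (p n (ket (0, x)))) = (\<lambda>x. if 0 \<in> F then apply_bcontfun (f 0) x else 0)"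
      unfolding F(2) using diagonal_coefficient_finite_sum[OF assms(1) F(1)] by blast
    show ?thesis unfolding eq by (cases "0 \<in> F") simp_all
  qed
  moreover have "uniform_limit UNIV (\<lambda>n x. cinner (ket (0, x)) (p n (ket (0, x))))
      (\<lambda>x. cinner (ket (0, x)) (a (ket (0, x)))) sequentially"
  proof (rule uniform_limitI)
    fix e :: real assume "e > 0"
    with lim have "\<forall>\<^sub>F n in sequentially. dist (p n) a < e" by (rule tendstoD)
    then show "\<forall>\<^sub>F n in sequentially. \<forall>x\<in>UNIV. dist (cinner (ket (0, x)) (p n (ket (0, x))))
        (cinner (ket (0, x)) (a (ket (0, x)))) < e"
    proof eventually_elim
      case (elim n)
      show ?case
      proof
        fix x
        show "dist (cinner (ket (0, x)) (p n (ket (0, x)))) (cinner (ket (0, x)) (a (ket (0, x)))) < e"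
          using elim cmod_diagonal_coefficient_le[of "(0, x)" "p n - a"]
          by (simp add: dist_norm blinfun.diff_left cinner_ket_diff)
      qed
    qed
  qed
  ultimately have "continuous_on UNIV (\<lambda>x. cinner (ket (0, x)) (a (ket (0, x))))"
    by (intro uniform_limit_theorem[where F = sequentially]) auto
  moreover have "bounded (range (\<lambda>x. cinner (ket (0, x)) (a (ket (0, x)))))"
    using cmod_diagonal_coefficient_le[of _ a] by (auto simp: bounded_iff intro!: exI[of _ "norm a"])
  ultimately show ?thesis by (simp add: bcontfun_def)
qed

lemma apply_canonical_expectation:
  assumes "flow act" "a \<in> reduced_crossed_product act"
  shows "apply_bcontfun (canonical_expectation a) x = cinner (ket (0, x)) (a (ket (0, x)))"
  by (simp add: canonical_expectation_def Bcontfun_inverse diagonal_coefficients_bcontfun[OF assms])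

lemma canonical_expectation_finite_sum:
  assumes "flow act" "finite F"
  shows "canonical_expectation (\<Sum>t\<in>F. coeff_op act (f t) o\<^sub>L unitary_op t) = (if 0 \<in> F then f 0 else 0)"
  unfolding canonical_expectation_def diagonal_coefficient_finite_sum[OF assms]
  by (auto simp: apply_bcontfun_inverse zero_bcontfun_def const_bcontfun_def)

lemma canonical_expectation_contractive:
  assumes "flow act" "a \<in> reduced_crossed_product act"
  shows "norm (canonical_expectation a) \<le> norm a"
  by (rule norm_bound) (simp add: apply_canonical_expectation[OF assms] cmod_diagonal_coefficient_le)

lemma canonical_expectation_diff:
  assumes "flow act" "a \<in> reduced_crossed_product act" "b \<in> reduced_crossed_product act"
  shows "canonical_expectation (a - b) = canonical_expectation a - canonical_expectation b"
proof -
  have "(\<lambda>x. cinner (ket (0, x)) ((a - b) (ket (0, x))))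
      = apply_bcontfun (canonical_expectation a - canonical_expectation b)"
    by (simp add: fun_eq_iff apply_canonical_expectation[OF assms(1)] assms blinfun.diff_left cinner_ket_diff)
  then show ?thesis
    by (simp only: canonical_expectation_def[of "a - b"] apply_bcontfun_inverse)
qed

end

theory Submission
  imports Defs
begin

text \<open>Conjugating \<open>\<Sum>\<^sub>t f\<^sub>t u\<^sub>t\<close> by \<open>u\<^sub>s\<close> and averaging over suitable \<open>s\<close> in the plump set of elements
  that almost fix \<open>f\<^sub>e\<close> leaves \<open>f\<^sub>e\<close> almost unchanged.  The functions \<open>f\<^sub>t\<close> with \<open>t \<noteq> e\<close> may be moved
  by \<open>s\<close>, but this does no harm: the matrix entries of the average of the \<open>(s.f\<^sub>t) u\<^bsub>sts\<inverse>\<^esub>\<close> are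
  dominated by those of \<open>\<parallel>f\<^sub>t\<parallel>\<close> times the average of the \<open>u\<^bsub>sts\<inverse>\<^esub>\<close>, a matrix with non-negative
  entries whose norm is small by plumpness.\<close>

section \<open>Entrywise domination and the fibres over the points of the space\<close>

lemma norm_ell2_mono:
  assumes "\<And>i. cmod (ell2_apply x i) \<le> cmod (ell2_apply y i)"
  shows "norm x \<le> norm y"
proof (rule power2_le_imp_le)
  show "(norm x)\<^sup>2 \<le> (norm y)\<^sup>2"
    unfolding norm_ell2_square
    by (intro infsum_mono ell2_summable power_mono assms) auto
qed simp

text \<open>Passing to moduli keeps the norm. It is used to write a sum of moduli of translated
  entries as a sum of translations applied to a single vector.\<close>

lift_definition abs_ell2 :: "'i ell2 \<Rightarrow> 'i ell2" is "\<lambda>f i. complex_of_real (cmod (f i))"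
  by simp

lemma norm_abs_ell2: "norm (abs_ell2 x) = norm x"
  by (intro antisym norm_ell2_mono) (simp_all add: abs_ell2.rep_eq)

text \<open>The component in the fibre over \<open>x\<close>. Each \<open>unitary_op t\<close> maps
  every fibre to itself and acts there as \<open>left_regular t\<close>, so norms known on the group
  alone can be used fibrewise.\<close>

lift_definition slice :: "'x \<Rightarrow> ('g \<times> 'x) ell2 \<Rightarrow> 'g ell2" is "\<lambda>x f s. f (s, x)"
proof -
  fix x :: 'x and f :: "'g \<times> 'x \<Rightarrow> complex"
  assume "(\<lambda>i. (cmod (f i))\<^sup>2) summable_on UNIV"
  then have "(\<lambda>i. (cmod (f i))\<^sup>2) summable_on range (\<lambda>s. (s, x))"
    by (rule summable_on_subset_banach) auto
  then show "(\<lambda>s. (cmod (f (s, x)))\<^sup>2) summable_on UNIV"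
    by (subst (asm) summable_on_reindex) (auto simp: inj_on_def o_def)
qed

text \<open>Pythagoras for the orthogonal decomposition into fibres. The double sum is swapped so
  that the point of the space becomes the outer index.\<close>

lemma slice_square_has_sum: "((\<lambda>x. (norm (slice x \<xi>))\<^sup>2) has_sum (norm \<xi>)\<^sup>2) UNIV"
proof -
  have "(\<lambda>i. (cmod (ell2_apply \<xi> i))\<^sup>2) summable_on UNIV"
    by (rule ell2_summable)
  then have "((\<lambda>i. (cmod (ell2_apply \<xi> i))\<^sup>2) has_sum (norm \<xi>)\<^sup>2) (UNIV \<times> UNIV)"
    unfolding norm_ell2_square by (simp add: has_sum_infsum)
  then have "((\<lambda>(x, s). (cmod (ell2_apply \<xi> (s, x)))\<^sup>2) has_sum (norm \<xi>)\<^sup>2) (UNIV \<times> UNIV)"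
    by (subst (asm) has_sum_swap) (simp add: case_prod_unfold)
  moreover have "((\<lambda>s. (cmod (ell2_apply \<xi> (s, x)))\<^sup>2) has_sum (norm (slice x \<xi>))\<^sup>2) UNIV" for x
    unfolding norm_ell2_square using ell2_summable[of "slice x \<xi>"]
    by (simp add: slice.rep_eq has_sum_infsum)
  ultimately show ?thesis
    using has_sum_SigmaD[where S = "(norm \<xi>)\<^sup>2" and A = UNIV and B = "\<lambda>_. UNIV"
        and f = "\<lambda>(x, s). (cmod (ell2_apply \<xi> (s, x)))\<^sup>2"
        and g = "\<lambda>x. (norm (slice x \<xi>))\<^sup>2"]
    by simp
qed

text \<open>On each fibre, the output is dominated entrywise by \<open>M\<close> times the sum of
  translations applied to the modulus of the input. This gives one bound for all fibres, and their
  squares add up.\<close>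

lemma norm_le_if_dominated_by_left_regular:
  fixes b :: "('g::group_add \<times> 'x) ell2 \<Rightarrow>\<^sub>L ('g \<times> 'x) ell2"
  assumes dom: "\<And>\<xi> s x. cmod (ell2_apply (b \<xi>) (s, x))
      \<le> M * (\<Sum>j\<in>J. cmod (ell2_apply \<xi> (- r j + s, x)))"
    and "0 \<le> M"
  shows "norm b \<le> M * norm (\<Sum>j\<in>J. left_regular (r j))"
proof (rule norm_blinfun_bound)
  define N where "N = M * norm (\<Sum>j\<in>J. left_regular (r j))"
  show "0 \<le> M * norm (\<Sum>j\<in>J. left_regular (r j))"
    using \<open>0 \<le> M\<close> by simp
  fix \<xi> :: "('g \<times> 'x) ell2"
  have slice_le: "norm (slice x (b \<xi>)) \<le> N * norm (slice x \<xi>)" for x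
  proof -
    \<comment> \<open>The sum of translations has non-negative entries, so on a vector of moduli
      nothing cancels: the entries of \<eta> are exactly the right-hand side of
      \<open>dom\<close>.\<close>
    define \<eta> where "\<eta> = M *\<^sub>R (\<Sum>j\<in>J. left_regular (r j)) (abs_ell2 (slice x \<xi>))"
    have "ell2_apply \<eta> s = complex_of_real (M * (\<Sum>j\<in>J. cmod (ell2_apply \<xi> (- r j + s, x))))" for s
      by (simp add: \<eta>_def scaleR_ell2.rep_eq blinfun_apply_sum ell2_apply_sum left_regular_apply
          abs_ell2.rep_eq slice.rep_eq)
    then have "cmod (ell2_apply (slice x (b \<xi>)) s) \<le> cmod (ell2_apply \<eta> s)" for s
      using dom[of \<xi> s x] by (simp only: slice.rep_eq norm_of_real)
    then have "norm (slice x (b \<xi>)) \<le> norm \<eta>"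
      by (rule norm_ell2_mono)
    also have "\<dots> \<le> M * (norm (\<Sum>j\<in>J. left_regular (r j)) * norm (abs_ell2 (slice x \<xi>)))"
      using \<open>0 \<le> M\<close> by (simp add: \<eta>_def norm_blinfun mult_left_mono)
    finally show ?thesis by (simp add: norm_abs_ell2 N_def mult.assoc)
  qed
  have "0 \<le> N" using \<open>0 \<le> M\<close> by (simp add: N_def)
  have "(norm (b \<xi>))\<^sup>2 \<le> N\<^sup>2 * (norm \<xi>)\<^sup>2"
  proof (rule has_sum_mono[OF slice_square_has_sum has_sum_cmult_right[OF slice_square_has_sum]])
    show "(norm (slice x (b \<xi>)))\<^sup>2 \<le> N\<^sup>2 * (norm (slice x \<xi>))\<^sup>2" for x
      using power_mono[OF slice_le[of x], of 2] by (simp add: power_mult_distrib)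
  qed
  then show "norm (b \<xi>) \<le> M * norm (\<Sum>j\<in>J. left_regular (r j)) * norm \<xi>"
    unfolding N_def[symmetric] power_mult_distrib[symmetric]
    by (rule power2_le_imp_le) (simp add: \<open>0 \<le> N\<close>)
qed

text \<open>Up to a value of \<open>f\<close>, the \<open>j\<close>-th conjugate only shifts entries
  by \<open>s j + t - s j\<close>. That value depends on \<open>j\<close> and on the entry, but its
  modulus is at most \<open>norm f\<close>, which is all that the domination requires.\<close>

lemma norm_sum_conjugates_le:
  "norm (\<Sum>j\<in>J. unitary_op (s j) o\<^sub>L (coeff_op act f o\<^sub>L unitary_op t) o\<^sub>L unitary_op (- s j))
    \<le> norm f * norm (\<Sum>j\<in>J. left_regular (s j + t - s j))"
proof (rule norm_le_if_dominated_by_left_regular)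
  fix \<xi> g x
  have "- (s j + t - s j) + g = s j + (- t + (- s j + g))" for j
    by (simp only: diff_conv_add_uminus minus_add minus_minus add.assoc)
  then show "cmod (ell2_apply ((\<Sum>j\<in>J. unitary_op (s j) o\<^sub>L (coeff_op act f o\<^sub>L unitary_op t)
        o\<^sub>L unitary_op (- s j)) \<xi>) (g, x))
      \<le> norm f * (\<Sum>j\<in>J. cmod (ell2_apply \<xi> (- (s j + t - s j) + g, x)))"
    unfolding blinfun_apply_sum ell2_apply_sum sum_distrib_left
    by (intro sum_norm_le)
      (simp add: unitary_op_apply coeff_op_apply norm_mult mult_right_mono norm_bounded)
qed simp

section \<open>Operator bounds and averages of conjugates\<close>

lemma norm_coeff_op_diff_le: "norm (coeff_op act f - coeff_op act g) \<le> norm (f - g)"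
proof (rule norm_blinfun_bound)
  fix \<xi>
  have "coeff_op act f - coeff_op act g = coeff_op act (f - g)"
    by (intro blinfun_eqI ell2_eqI)
      (auto simp: blinfun.diff_left minus_ell2.rep_eq coeff_op_apply algebra_simps)
  moreover have "norm (coeff_op act (f - g) \<xi>) \<le> norm (f - g) * norm \<xi>"
    unfolding coeff_op_def mult_op.rep_eq
    by (rule norm_mult_fun_le) (simp only: case_prod_unfold norm_bounded)
  ultimately show "norm ((coeff_op act f - coeff_op act g) \<xi>) \<le> norm (f - g) * norm \<xi>"
    by simp
qed simp

lemma unitary_op_0: "unitary_op 0 = id_blinfun"
  by (intro blinfun_eqI ell2_eqI) (auto simp: unitary_op_apply)

lemma norm_unitary_op_le: "norm (unitary_op t) \<le> 1"
  by (rule norm_blinfun_bound)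
    (simp_all add: unitary_op_def perm_op.rep_eq norm_perm_fun[OF bij_left_shift_fst])

lemma norm_conjugate_le:
  fixes a :: "('g::group_add \<times> 'x) ell2 \<Rightarrow>\<^sub>L ('g \<times> 'x) ell2"
  shows "norm (unitary_op s o\<^sub>L a o\<^sub>L unitary_op (- s)) \<le> norm a"
proof -
  let ?u = "unitary_op :: 'g \<Rightarrow> ('g \<times> 'x) ell2 \<Rightarrow>\<^sub>L ('g \<times> 'x) ell2"
  have "norm (?u s o\<^sub>L a o\<^sub>L ?u (- s)) \<le> norm (?u s) * norm a * norm (?u (- s))"
    by (rule order_trans[OF norm_blinfun_compose mult_right_mono[OF norm_blinfun_compose norm_ge_zero]])
  also have "\<dots> \<le> 1 * norm a * 1"
    by (intro mult_mono norm_unitary_op_le) auto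
  finally show ?thesis by simp
qed

lemma norm_average_le:
  fixes v :: "nat \<Rightarrow> 'a::real_normed_vector"
  assumes "m > 0" "\<And>j. j < m \<Longrightarrow> norm (v j) \<le> B"
  shows "norm ((1 / real m) *\<^sub>R (\<Sum>j<m. v j)) \<le> B"
proof -
  have "norm (\<Sum>j<m. v j) \<le> real m * B"
    using sum_norm_bound[of "{..<m}" v B] assms by simp
  then show ?thesis using assms(1) by (simp add: field_simps)
qed

lemma unitary_op_in_reduced_group_algebra: "unitary_op t \<in> reduced_group_algebra"
proof -
  have "unitary_op t = (\<Sum>t\<in>{t}. scaleC_op 1 (unitary_op t))"
    by (auto intro!: blinfun_eqI ell2_eqI simp: scaleC_op_apply)
  then have "unitary_op t \<in> {\<Sum>t\<in>F. scaleC_op (c t) (unitary_op t) | F c. finite F}"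
    by (intro CollectI exI[of _ "{t}"] exI[of _ "\<lambda>_. 1"] conjI) auto
  then show ?thesis
    unfolding reduced_group_algebra_def by (rule subsetD[OF closure_subset])
qed

text \<open>Averages carry a real scalar, whereas \<open>cstar_algebra\<close> speaks of
  \<open>scaleC_op\<close>; the two scalings agree for real numbers.\<close>

lemma cstar_algebra_average:
  assumes A: "cstar_algebra A" and v: "\<And>j. j \<in> J \<Longrightarrow> v j \<in> A"
  shows "r *\<^sub>R (\<Sum>j\<in>J. v j) \<in> A"
proof -
  have "(\<Sum>j\<in>J. v j) \<in> A"
    using v A by (induction J rule: infinite_finite_induct) (auto simp: cstar_algebra_def)
  then have "scaleC_op (complex_of_real r) (\<Sum>j\<in>J. v j) \<in> A"
    using A by (simp add: cstar_algebra_def)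
  also have "scaleC_op (complex_of_real r) (\<Sum>j\<in>J. v j) = r *\<^sub>R (\<Sum>j\<in>J. v j)"
    by (intro blinfun_eqI ell2_eqI) (simp add: scaleC_op_apply blinfun.scaleR_left scaleR_ell2.rep_eq)
  finally show ?thesis .
qed

text \<open>Four errors of size at most \<delta> add up: replacing \<open>a\<close> by a finite sum
  \<open>p\<close>, moving the coefficient \<open>h\<close> of \<open>p\<close> at the neutral
  element, the averaged remainder \<open>q\<close>, and replacing the expectation of
  \<open>p\<close> by that of \<open>a\<close>.\<close>

lemma plump_average_near_expectation:
  fixes act :: "'g::group_add \<Rightarrow> 'x::t2_space \<Rightarrow> 'x"
  assumes flow: "flow act"
    and plump: "\<And>(f :: 'x \<Rightarrow>\<^sub>C complex) \<epsilon>::real. \<epsilon> > 0 \<Longrightarrow> plump {s. norm (translate act s f - f) < \<epsilon>}"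
    and a: "a \<in> reduced_crossed_product act" and "\<delta> > 0"
  obtains m :: nat and s where "m > 0"
    "norm ((1 / real m) *\<^sub>R (\<Sum>j<m. unitary_op (s j) o\<^sub>L a o\<^sub>L unitary_op (- s j))
      - coeff_op act (canonical_expectation a)) < 4 * \<delta>"
proof -
  obtain p where "p \<in> {\<Sum>t\<in>F. coeff_op act (f t) o\<^sub>L unitary_op t | F f. finite F}" "dist p a < \<delta>"
    using a \<open>\<delta> > 0\<close> unfolding reduced_crossed_product_def closure_approachable by blast
  then obtain F f where F: "finite F" and p: "p = (\<Sum>t\<in>F. coeff_op act (f t) o\<^sub>L unitary_op t)"
    and ap: "norm (a - p) < \<delta>"
    by (auto simp: dist_norm norm_minus_commute)
  have p_in: "p \<in> reduced_crossed_product act"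
    unfolding p reduced_crossed_product_def using F by (intro subsetD[OF closure_subset]) blast
  define h where "h = canonical_expectation p"
  define q where "q = (\<Sum>t\<in>F - {0}. coeff_op act (f t) o\<^sub>L unitary_op t)"
  have h: "h = (if 0 \<in> F then f 0 else 0)"
    unfolding h_def p by (rule canonical_expectation_finite_sum[OF flow F])
  have coeff_0: "coeff_op act 0 = 0"
    by (intro blinfun_eqI ell2_eqI) (auto simp: coeff_op_apply zero_ell2.rep_eq)
  \<comment> \<open>If \<open>0\<close> is not in \<open>F\<close>, then \<open>h\<close> is zero
    and \<open>q\<close> is all of \<open>p\<close>.\<close>
  have p_split: "p = coeff_op act h + q"
    using F by (cases "0 \<in> F")
      (auto simp: p q_def h sum.remove[of F 0] coeff_0 unitary_op_0 intro!: blinfun_eqI)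
  define S where "S = (\<Sum>t\<in>F - {0}. norm (f t))"
  have "S \<ge> 0" by (simp add: S_def sum_nonneg)
  \<comment> \<open>The summand 1 avoids division by zero when \<open>S\<close> vanishes and makes
    \<open>S * \<gamma> < \<delta>\<close> strict.\<close>
  define \<gamma> where "\<gamma> = \<delta> / (S + 1)"
  have "\<gamma> > 0" "S * \<gamma> < \<delta>"
    using \<open>S \<ge> 0\<close> \<open>\<delta> > 0\<close> by (auto simp: \<gamma>_def field_simps)
  \<comment> \<open>Only \<open>h\<close> has to be almost fixed by the \<open>s j\<close>. A single
    choice of them serves all the finitely many \<open>t\<close> in \<open>F - {0}\<close>.\<close>
  from plump[OF \<open>\<delta> > 0\<close>, of h] \<open>\<gamma> > 0\<close> F obtain m s where "m > 0"
    and s: "\<And>j. j < m \<Longrightarrow> norm (translate act (s j) h - h) < \<delta>"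
    and avg: "\<And>t. t \<in> F - {0} \<Longrightarrow>
      norm ((1 / real m) *\<^sub>R (\<Sum>j<m. left_regular (s j + t - s j))) < \<gamma>"
    unfolding plump_def
    by (elim conjE allE[of _ \<gamma>] impE allE[of _ "F - {0}"]) auto
  define C where "C = (\<lambda>j b. unitary_op (s j) o\<^sub>L b o\<^sub>L unitary_op (- s j)
    :: ('g \<times> 'x) ell2 \<Rightarrow>\<^sub>L ('g \<times> 'x) ell2)"
  define \<Phi> where "\<Phi> b = (1 / real m) *\<^sub>R (\<Sum>j<m. C j b)" for b
  have C_add: "C j (b + c) = C j b + C j c" for j b c
    by (intro blinfun_eqI) (simp add: C_def blinfun.add_left blinfun.add_right)
  have C_sum: "C j (\<Sum>t\<in>T. b t) = (\<Sum>t\<in>T. C j (b t))" for j b and T :: "'g set"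
    by (intro blinfun_eqI) (simp add: C_def blinfun_apply_sum blinfun.sum_right)
  have \<Phi>_add: "\<Phi> (b + c) = \<Phi> b + \<Phi> c" for b c
    by (simp add: \<Phi>_def C_add sum.distrib scaleR_add_right)
  have "norm (\<Phi> (a - p)) \<le> norm (a - p)"
    unfolding \<Phi>_def C_def by (intro norm_average_le \<open>m > 0\<close> norm_conjugate_le)
  \<comment> \<open>By covariance the conjugates are the coefficients of the translates of
    \<open>h\<close>, each within \<delta> of \<open>h\<close>.\<close>
  moreover have "norm (\<Phi> (coeff_op act h) - coeff_op act h) \<le> \<delta>"
  proof -
    have "\<Phi> (coeff_op act h) - coeff_op act h
        = (1 / real m) *\<^sub>R (\<Sum>j<m. coeff_op act (translate act (s j) h) - coeff_op act h)"
      using \<open>m > 0\<close>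
      by (simp add: \<Phi>_def C_def covariance[OF flow] sum_subtractf scaleR_diff_right sum_constant_scaleR)
    also have "norm \<dots> \<le> \<delta>"
      by (intro norm_average_le \<open>m > 0\<close> order_trans[OF norm_coeff_op_diff_le] less_imp_le s)
    finally show ?thesis .
  qed
  moreover have "norm (\<Phi> q) < \<delta>"
  proof -
    \<comment> \<open>Plumpness makes each term small, whatever the translations do to
      \<open>f t\<close>.\<close>
    have "norm ((1 / real m) *\<^sub>R (\<Sum>j<m. C j (coeff_op act (f t) o\<^sub>L unitary_op t)))
        \<le> norm (f t) * \<gamma>" if "t \<in> F - {0}" for t
    proof -
      have "norm ((1 / real m) *\<^sub>R (\<Sum>j<m. C j (coeff_op act (f t) o\<^sub>L unitary_op t)))
          \<le> (1 / real m) * (norm (f t) * norm (\<Sum>j<m. left_regular (s j + t - s j)))"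
        unfolding C_def norm_scaleR
        by (simp only: abs_of_nonneg of_nat_0_le_iff zero_le_divide_1_iff)
          (intro mult_left_mono norm_sum_conjugates_le, simp)
      also have "\<dots> = norm (f t) * norm ((1 / real m) *\<^sub>R (\<Sum>j<m. left_regular (s j + t - s j)))"
        by simp
      also have "\<dots> \<le> norm (f t) * \<gamma>"
        by (intro mult_left_mono less_imp_le[OF avg[OF that]] norm_ge_zero)
      finally show ?thesis .
    qed
    then have "norm (\<Sum>t\<in>F - {0}. (1 / real m) *\<^sub>R (\<Sum>j<m. C j (coeff_op act (f t) o\<^sub>L unitary_op t)))
        \<le> (\<Sum>t\<in>F - {0}. norm (f t) * \<gamma>)"
      by (rule sum_norm_le)
    also have "(\<Sum>t\<in>F - {0}. (1 / real m) *\<^sub>R (\<Sum>j<m. C j (coeff_op act (f t) o\<^sub>L unitary_op t))) = \<Phi> q"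
      unfolding \<Phi>_def q_def C_sum scaleR_sum_right[symmetric] by (subst sum.swap) simp
    finally show ?thesis
      using \<open>S * \<gamma> < \<delta>\<close> by (simp add: S_def sum_distrib_right)
  qed
  \<comment> \<open>At each point the two expectations differ by a diagonal coefficient of
    \<open>p - a\<close>.\<close>
  moreover have "norm (coeff_op act h - coeff_op act (canonical_expectation a)) \<le> norm (p - a)"
  proof -
    have "norm (h - canonical_expectation a) \<le> norm (p - a)"
    proof (rule norm_bound)
      fix x
      show "norm (apply_bcontfun (h - canonical_expectation a) x) \<le> norm (p - a)"
        using cmod_diagonal_coefficient_le[of "(0, x)" "p - a"]
        by (simp add: h_def apply_canonical_expectation[OF flow] p_in a blinfun.diff_left cinner_ket_diff)
    qed
    then show ?thesis
      using norm_coeff_op_diff_le order_trans by blast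
  qed
  moreover have "\<Phi> a - coeff_op act (canonical_expectation a)
      = \<Phi> (a - p) + ((\<Phi> (coeff_op act h) - coeff_op act h) + (\<Phi> q
        + (coeff_op act h - coeff_op act (canonical_expectation a))))"
    using \<Phi>_add[of "a - p" p] \<Phi>_add[of "coeff_op act h" q] by (simp add: p_split)
  ultimately have "norm (\<Phi> a - coeff_op act (canonical_expectation a)) < 4 * \<delta>"
    using ap norm_minus_commute[of a p] by (smt (verit) norm_triangle_ineq)
  then show ?thesis
    using that[OF \<open>m > 0\<close>] by (simp add: \<Phi>_def C_def)
qed

theorem theorem3p4:
  fixes act :: "'g::{group_add, countable} \<Rightarrow> 'x::t2_space \<Rightarrow> 'x"
  assumes "flow act"
    and "\<And>(f :: 'x \<Rightarrow>\<^sub>C complex) \<epsilon>::real. \<epsilon> > 0 \<Longrightarrow> plump {s. norm (translate act s f - f) < \<epsilon>}"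
  shows "almost_reflecting act"
  unfolding almost_reflecting_def
proof (intro allI impI image_subsetI, elim conjE)
  fix A and a :: "('g \<times> 'x) ell2 \<Rightarrow>\<^sub>L ('g \<times> 'x) ell2"
  assume A: "cstar_algebra A" "reduced_group_algebra \<subseteq> A" "A \<subseteq> reduced_crossed_product act"
    and "a \<in> A"
  \<comment> \<open>Since \<open>A\<close> is closed, it suffices to approximate the expectation
    from within \<open>A\<close>. The averages of conjugates do so, because \<open>A\<close>
    contains \<open>a\<close> and all the canonical unitaries.\<close>
  have "\<exists>b\<in>A. dist b (coeff_op act (canonical_expectation a)) < \<epsilon>" if "\<epsilon> > 0" for \<epsilon>
  proof -
    from that A(3) \<open>a \<in> A\<close> obtain m :: nat and s where
      "norm ((1 / real m) *\<^sub>R (\<Sum>j<m. unitary_op (s j) o\<^sub>L a o\<^sub>L unitary_op (- s j))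
        - coeff_op act (canonical_expectation a)) < 4 * (\<epsilon> / 4)"
      using plump_average_near_expectation[OF assms, of a "\<epsilon> / 4"]
      by (metis subsetD zero_less_divide_iff zero_less_numeral)
    moreover have "unitary_op g \<in> A" for g
      using A(2) unitary_op_in_reduced_group_algebra by blast
    then have "unitary_op (s j) o\<^sub>L a o\<^sub>L unitary_op (- s j) \<in> A" for j
      using A(1) \<open>a \<in> A\<close> by (simp add: cstar_algebra_def)
    then have "(1 / real m) *\<^sub>R (\<Sum>j<m. unitary_op (s j) o\<^sub>L a o\<^sub>L unitary_op (- s j)) \<in> A"
      by (intro cstar_algebra_average A(1))
    ultimately show ?thesis
      by (auto simp: dist_norm)
  qed
  moreover have "closed A"
    using A(1) by (simp add: cstar_algebra_def)
  ultimately show "coeff_op act (canonical_expectation a) \<in> A"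
    using closed_approachable by blast
qed

end
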